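(* Let $$A=\sum_{n\ge 0}t^n\sum_{\sigma\in\mathcal S_n(132)}y^{\mathrm{des}(\sigma)}x_1^{123\text{-mch}(\sigma)}x_2^{213\text{-mch}(\sigma)}x_3^{231\text{-mch}(\sigma)}x_4^{321\text{-mch}(\sigma)} .$$ Then $A=N/D$, where $$D=2x_3 t y\,(-x_1 x_4 t+x_3 t+x_4)\,(-x_1x_4 ty+x_1+x_2 x_3 t y)$$ and $$\begin{aligned} N={}&2 x_1^2 x_3 x_4^2 t^4 y^2+2 x_1^2 x_3 x_4^2 t^3 y^2-2x_1^2 x_3 x_4 t^4 y^2-2 x_1^2 x_3 x_4 t^3 y-2 x_1^2x_3 x_4 t^2 y+x_1^2 x_3 t^3 y-x_1^2 x_4 t^3 y+x_1^2t^2\\ &-2 x_1 x_2 x_3^2 x_4 t^4 y^2-2 x_1 x_2 x_3^2x_4 t^3 y^2+x_1 x_2 x_3^2 t^4 y^2+x_1 x_2 x_3x_4 t^4 y^2\\ &+(x_1 t-x_3 t-1) (x_3 t y-x_4 t y+1)\sqrt{(x_1 t+t y ((x_2-1) x_3 t-x_4)+1)^2-4 t (-x_1x_4t y+x_1+x_2 x_3 t y)}\\ &+x_1 x_2 x_3 t^3 y-2 x_1x_3^2 x_4 t^3 y^2+x_1 x_3^2 t^4 y^2+x_1 x_3^2 t^3 y+2x_1 x_3^2 t^2 y-2 x_1 x_3 x_4^2 t^4 y^2-2 x_1 x_3x_4^2 t^3 y^2\\ &-2 x_1 x_3 x_4^2 t^2 y^2+x_1 x_3 x_4t^4 y^2+3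 x_1 x_3 x_4 t^3 y^2+3 x_1 x_3 x_4 t^3 y+2x_1 x_3 x_4 t^2 y+2 x_1 x_3 x_4 t y\\ &-x_1 x_3t^3 y-2 x_1 x_3 t^2 y-x_1 x_3 t^2-x_1 x_4^2 t^3 y^2+3x_1 x_4 t^2 y-2 x_1 t\\ &+x_2 x_3^3 t^4 y^2+2 x_2 x_3^3t^3 y^2+x_2 x_3^2 x_4 t^4 y^2+2 x_2 x_3^2 x_4 t^3 y^2+2x_2 x_3^2 x_4 t^2 y^2-2 x_2 x_3^2 t^4 y^2-x_2 x_3^2t^3 y^2\\ &-x_2 x_3^2 t^3 y-x_2 x_3 x_4 t^3 y^2-x_2 x_3t^2 y-x_3^3 t^4 y^2+x_3^2 x_4 t^4 y^2-x_3^2 x_4 t^3y^2-x_3^2 t^3 y^2-x_3^2 t^3 y+x_3^2 t^2 y\\ &+x_3 x_4^2 t^3y^2+x_3 x_4 t^3 y^2-x_3 x_4 t^2 y^2-2 x_3 x_4 t^2y-x_3 t^2 y+x_3 t y+x_3 t+x_4^2 t^2 y^2-2 x_4 t y+1 . \end{aligned}$$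
   Context: $\mathcal S_n$ is the set of permutations of $\{1,\dots,n\}$ in one-line notation ($\mathcal S_0$ contains only the empty permutation, on which all statistics are $0$). For a word $w$ of distinct integers, $\mathrm{red}(w)$ replaces the $i$-th smallest letter by $i$. $\sigma\in\mathcal S_n$ avoids $\lambda\in\mathcal S_k$ (classical avoidance) if no (not necessarily contiguous) subsequence $\sigma_{i_1}\cdots\sigma_{i_k}$, $i_1<\dots<i_k$, has reduction $\lambda$; $\mathcal S_n(\lambda)$ is the set of such $\sigma$. $\gamma\text{-mch}(\sigma)$ is the number of $i$ with $\mathrm{red}(\sigma_i\sigma_{i+1}\cdots\sigma_{i+k-1})=\gamma$ for $\gamma\in\mathcal S_k$. $\mathrm{des}(\sigma)=|\{i:\sigma_i>\sigma_{i+1}\}|$. The identity is in the fraction field of $\mathbb Q[y,x_1,x_2,x_3,x_4][[t]]$; the square root is the power series in $t$ with constant term $1$. *)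

theory Defs
  imports
    "HOL-Computational_Algebra.Computational_Algebra"
    "HOL-Combinatorics.Multiset_Permutations"
    "HOL-Library.Sublist"
begin

definition red :: "nat list \<Rightarrow> nat list" where
  "red w = map (\<lambda>a. card {b \<in> set w. b \<le> a}) w"

text \<open>\<^const>\<open>subseq\<close> is the library's order-preserving, not necessarily contiguous,
  subsequence relation.\<close>

definition avoids :: "nat list \<Rightarrow> nat list \<Rightarrow> bool" where
  "avoids \<sigma> p \<longleftrightarrow> \<not> (\<exists>w. subseq w \<sigma> \<and> red w = p)"

definition Av :: "nat \<Rightarrow> nat list \<Rightarrow> nat list set" where
  "Av n p = {\<sigma> \<in> permutations_of_set {1..n}. avoids \<sigma> p}"

text \<open>Positions are counted from 0.\<close>

definition mch :: "nat list \<Rightarrow> nat list \<Rightarrow> nat" where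
  "mch p \<sigma> = card {i. i + length p \<le> length \<sigma> \<and> red (take (length p) (drop i \<sigma>)) = p}"

definition des :: "nat list \<Rightarrow> nat" where
  "des \<sigma> = card {i. Suc i < length \<sigma> \<and> \<sigma> ! i > \<sigma> ! Suc i}"

definition gf_des_mch :: "'a::comm_semiring_1 \<Rightarrow> 'a \<Rightarrow> 'a \<Rightarrow> 'a \<Rightarrow> 'a \<Rightarrow> 'a fps" where
  "gf_des_mch y x1 x2 x3 x4 = Abs_fps (\<lambda>n. \<Sum>\<sigma>\<in>Av n [1,3,2].
     y ^ des \<sigma> * x1 ^ mch [1,2,3] \<sigma> * x2 ^ mch [2,1,3] \<sigma>
       * x3 ^ mch [2,3,1] \<sigma> * x4 ^ mch [3,2,1] \<sigma>)"

text \<open>\<open>\<rat>[y,x\<^sub>1,x\<^sub>2,x\<^sub>3,x\<^sub>4]\<close> as an iterated univariate polynomial ring, with \<open>y\<close> the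
  indeterminate of the outermost layer and \<open>x\<^sub>4\<close> that of the innermost one.\<close>

type_synonym qpoly = "rat poly poly poly poly poly"

definition Y :: qpoly where "Y = [:0, 1:]"
definition X1 :: qpoly where "X1 = [:[:0, 1:]:]"
definition X2 :: qpoly where "X2 = [:[:[:0, 1:]:]:]"
definition X3 :: qpoly where "X3 = [:[:[:[:0, 1:]:]:]:]"
definition X4 :: qpoly where "X4 = [:[:[:[:[:0, 1:]:]:]:]:]"

text \<open>A definite description; well-definedness over \<^typ>\<open>qpoly\<close> for every series with
  constant term 1 is \<open>fps_sqrt1_unique_existence\<close>.\<close>

definition fps_sqrt1 :: "'a::comm_ring_1 fps \<Rightarrow> 'a fps" where
  "fps_sqrt1 f = (THE s. fps_nth s 0 = 1 \<and> s\<^sup>2 = f)"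

lemma fps_sqrt1_unique:
  fixes s s' :: "'a :: {idom, ring_char_0} fps"
  assumes "fps_nth s 0 = 1" "fps_nth s' 0 = 1" "s\<^sup>2 = s'\<^sup>2"
  shows "s = s'"
proof -
  have "s = s' \<or> s = - s'"
    using assms(3) by (simp add: power2_eq_iff)
  moreover have "s \<noteq> - s'"
  proof
    assume "s = - s'"
    hence "(1::'a) = - 1"
      using assms(1,2) by (metis fps_neg_nth)
    thus False by simp
  qed
  ultimately show ?thesis by blast
qed

lemma fps_sqrt1_unique_existence:
  fixes f :: "qpoly fps"
  assumes f0: "fps_nth f 0 = 1"
  shows "\<exists>!s. fps_nth s 0 = 1 \<and> s\<^sup>2 = f"
proof -
  define h :: "rat \<Rightarrow> qpoly" where "h = (\<lambda>c. [:[:[:[:[:c:]:]:]:]:])"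
  have h0: "h 0 = 0" and h1: "h 1 = 1" and h_add: "h (a + b) = h a + h b"
    and h_mult: "h (a * b) = h a * h b" for a b
    by (simp_all add: h_def one_pCons)
  have h_sum: "h (sum g A) = (\<Sum>i\<in>A. h (g i))" for g and A :: "nat set"
    by (induction A rule: infinite_finite_induct) (simp_all add: h0 h_add)
  define b :: "rat fps" where "b = fps_binomial (1/2)"
  have "b * b = 1 + fps_X"
    by (simp add: b_def fps_binomial_add_mult [symmetric] fps_binomial_1)
  define c where "c = Abs_fps (\<lambda>n. h (fps_nth b n))"
  have "fps_nth (c * c) n = fps_nth (1 + fps_X) n" for n
  proof -
    have "fps_nth (c * c) n = h (fps_nth (b * b) n)"
      by (simp add: c_def fps_mult_nth h_sum h_mult)
    also have "\<dots> = h (fps_nth (1 + fps_X) n)"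
      using \<open>b * b = 1 + fps_X\<close> by simp
    also have "\<dots> = fps_nth (1 + fps_X) n"
      by (simp add: fps_X_def h0 h1)
    finally show ?thesis .
  qed
  hence cc: "c * c = 1 + fps_X" by (simp add: fps_eq_iff)
  define s where "s = c oo (f - 1)"
  have f1: "fps_nth (f - 1) 0 = 0" using f0 by simp
  have "s\<^sup>2 = (c * c) oo (f - 1)"
    using f1 by (simp add: s_def power2_eq_square fps_compose_mult_distrib)
  also have "\<dots> = f"
    using f1 by (simp add: cc fps_compose_add_distrib)
  finally have s2: "s\<^sup>2 = f" .
  have s0: "fps_nth s 0 = 1"
    by (simp add: s_def c_def b_def h1)
  show ?thesis
    using s0 s2 fps_sqrt1_unique by blast
qed

definition radicand :: "'a::comm_ring_1 \<Rightarrow> 'a \<Rightarrow> 'a \<Rightarrow> 'a \<Rightarrow> 'a \<Rightarrow> 'a \<Rightarrow> 'a" where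
  "radicand t y x1 x2 x3 x4 =
     (x1 * t + t * y * ((x2 - 1) * x3 * t - x4) + 1)^2
       - 4 * t * (- x1 * x4 * t * y + x1 + x2 * x3 * t * y)"

definition denom :: "'a::comm_ring_1 \<Rightarrow> 'a \<Rightarrow> 'a \<Rightarrow> 'a \<Rightarrow> 'a \<Rightarrow> 'a \<Rightarrow> 'a" where
  "denom t y x1 x2 x3 x4 =
     2 * x3 * t * y * (- x1 * x4 * t + x3 * t + x4) * (- x1 * x4 * t * y + x1 + x2 * x3 * t * y)"

text \<open>The argument \<open>r\<close> stands for the square root of the radicand.\<close>

definition numer :: "'a::comm_ring_1 \<Rightarrow> 'a \<Rightarrow> 'a \<Rightarrow> 'a \<Rightarrow> 'a \<Rightarrow> 'a \<Rightarrow> 'a \<Rightarrow> 'a" where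
  "numer r t y x1 x2 x3 x4 =
     2 * x1^2 * x3 * x4^2 * t^4 * y^2 + 2 * x1^2 * x3 * x4^2 * t^3 * y^2
      - 2 * x1^2 * x3 * x4 * t^4 * y^2 - 2 * x1^2 * x3 * x4 * t^3 * y
      - 2 * x1^2 * x3 * x4 * t^2 * y + x1^2 * x3 * t^3 * y - x1^2 * x4 * t^3 * y + x1^2 * t^2
      - 2 * x1 * x2 * x3^2 * x4 * t^4 * y^2 - 2 * x1 * x2 * x3^2 * x4 * t^3 * y^2
      + x1 * x2 * x3^2 * t^4 * y^2 + x1 * x2 * x3 * x4 * t^4 * y^2
      + (x1 * t - x3 * t - 1) * (x3 * t * y - x4 * t * y + 1) * r + x1 * x2 * x3 * t^3 * y
      - 2 * x1 * x3^2 * x4 * t^3 * y^2 + x1 * x3^2 * t^4 * y^2 + x1 * x3^2 * t^3 * y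
      + 2 * x1 * x3^2 * t^2 * y - 2 * x1 * x3 * x4^2 * t^4 * y^2
      - 2 * x1 * x3 * x4^2 * t^3 * y^2 - 2 * x1 * x3 * x4^2 * t^2 * y^2
      + x1 * x3 * x4 * t^4 * y^2 + 3 * x1 * x3 * x4 * t^3 * y^2 + 3 * x1 * x3 * x4 * t^3 * y
      + 2 * x1 * x3 * x4 * t^2 * y + 2 * x1 * x3 * x4 * t * y - x1 * x3 * t^3 * y
      - 2 * x1 * x3 * t^2 * y - x1 * x3 * t^2 - x1 * x4^2 * t^3 * y^2 + 3 * x1 * x4 * t^2 * y
      - 2 * x1 * t + x2 * x3^3 * t^4 * y^2 + 2 * x2 * x3^3 * t^3 * y^2
      + x2 * x3^2 * x4 * t^4 * y^2 + 2 * x2 * x3^2 * x4 * t^3 * y^2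
      + 2 * x2 * x3^2 * x4 * t^2 * y^2 - 2 * x2 * x3^2 * t^4 * y^2 - x2 * x3^2 * t^3 * y^2
      - x2 * x3^2 * t^3 * y - x2 * x3 * x4 * t^3 * y^2 - x2 * x3 * t^2 * y - x3^3 * t^4 * y^2
      + x3^2 * x4 * t^4 * y^2 - x3^2 * x4 * t^3 * y^2 - x3^2 * t^3 * y^2 - x3^2 * t^3 * y
      + x3^2 * t^2 * y + x3 * x4^2 * t^3 * y^2 + x3 * x4 * t^3 * y^2 - x3 * x4 * t^2 * y^2
      - 2 * x3 * x4 * t^2 * y - x3 * t^2 * y + x3 * t * y + x3 * t + x4^2 * t^2 * y^2
      - 2 * x4 * t * y + 1"

end

theory Submission
  imports Defs
begin

text \<open>
  A 132-avoiding permutation is \<open>L n R\<close> with every letter of \<open>L\<close> above every letter of \<open>R\<close>. Among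
  the windows that meet \<open>n\<close>, those ending in \<open>n\<close> depend only on whether \<open>L\<close> ends with an ascent,
  those starting with \<open>n\<close> only on whether \<open>R\<close> starts with a descent, and the one centred at \<open>n\<close>
  is always a match of 231. Splitting the left factors by their first step (series \<open>a\<close>, \<open>d\<close>) and
  the right factors by their last step (series \<open>q\<close>, \<open>b\<close>) gives a closed polynomial system. With
  \<open>G = x\<^sub>1(1 + x\<^sub>3 q) + x\<^sub>2 x\<^sub>3 b\<close>, \<open>H = x\<^sub>4 + x\<^sub>3(a + x\<^sub>4 d)\<close>, \<open>g = 1 - t G\<close> and \<open>h = 1 - t y H\<close> it
  collapses to \<open>(1 - g) h = t c\<close> and \<open>(1 - h) g = t y e\<close>, where \<open>c\<close> and \<open>e\<close> are the two factors of
  the denominator. So \<open>h\<close> is a root of a quadratic whose discriminant is the radicand, and \<open>A\<close> is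
  read off from \<open>x\<^sub>3 A = x\<^sub>3 + t (x\<^sub>3 - 1) + t K / (g h)\<close> with \<open>K\<close> explicit.
\<close>

section \<open>Statistics of words\<close>

lemma red_triple:
  "red [a, b, c] = [1, 2, 3] \<longleftrightarrow> a < b \<and> b < c"
  "red [a, b, c] = [2, 1, 3] \<longleftrightarrow> b < a \<and> a < c"
  "red [a, b, c] = [2, 3, 1] \<longleftrightarrow> c < a \<and> a < b"
  "red [a, b, c] = [3, 2, 1] \<longleftrightarrow> c < b \<and> b < a"
  "red [a, b, c] = [1, 3, 2] \<longleftrightarrow> a < c \<and> c < b"
proof -
  \<comment> \<open>Peeling one letter at a time off the counted set makes every rank in
    \<open>red\<close> an explicit number once the comparisons are known.\<close>
  have *: "{x. (x = u \<or> P x) \<and> x \<le> v} = (if u \<le> v then insert u {x. P x \<and> x \<le> v} else {x. P x \<and> x \<le> v})"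
    "{x. x = u \<and> x \<le> v} = (if u \<le> v then {u} else {})" for P and u v :: nat
    by auto
  show "red [a, b, c] = [1, 2, 3] \<longleftrightarrow> a < b \<and> b < c"
    "red [a, b, c] = [2, 1, 3] \<longleftrightarrow> b < a \<and> a < c"
    "red [a, b, c] = [2, 3, 1] \<longleftrightarrow> c < a \<and> a < b"
    "red [a, b, c] = [3, 2, 1] \<longleftrightarrow> c < b \<and> b < a"
    "red [a, b, c] = [1, 3, 2] \<longleftrightarrow> a < c \<and> c < b"
    by (auto simp: red_def * card_insert_if)
qed

lemma length_red [simp]: "length (red w) = length w"
  by (simp add: red_def)

text \<open>Positions in \<open>a # w\<close> are 0 and the successors of those in \<open>w\<close>,
  so \<open>des\<close> and \<open>mch\<close> become recursions along the list.\<close>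

lemma card_Collect_nat_shift:
  assumes "finite {i. P (Suc i)}"
  shows "card {i. P i} = (if P 0 then 1 else 0) + card {i. P (Suc i)}"
proof -
  have "{i. P i} = (if P 0 then {0} else {}) \<union> Suc ` {i. P (Suc i)}" (is "_ = ?A \<union> ?B")
    by (auto simp: image_iff) (metis not0_implies_Suc)+
  moreover have "card (?A \<union> ?B) = card ?A + card ?B"
    using assms by (intro card_Un_disjoint) auto
  ultimately show ?thesis
    by (simp add: card_image)
qed

lemma des_simps [simp]:
  "des [] = 0" "des [a] = 0"
  "des (a # b # w) = (if a > b then 1 else 0) + des (b # w)"
proof -
  show "des [] = 0" "des [a] = 0" by (simp_all add: des_def)
  have "finite {i. Suc (Suc i) < length (a # b # w) \<and> Q i}" for Q
    by (rule finite_subset [of _ "{..<length w}"]) auto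
  then show "des (a # b # w) = (if a > b then 1 else 0) + des (b # w)"
    unfolding des_def by (subst card_Collect_nat_shift) auto
qed

lemma mch_Cons:
  "mch p (a # w) = (if length p \<le> Suc (length w) \<and> red (take (length p) (a # w)) = p then 1 else 0) + mch p w"
proof -
  have "finite {i. Suc i + length p \<le> length (a # w) \<and> Q i}" for Q
    by (rule finite_subset [of _ "{..length w}"]) auto
  then show ?thesis
    unfolding mch_def by (subst card_Collect_nat_shift) auto
qed

lemma mch_triple_simps [simp]:
  "mch [i, j, k] [] = 0" "mch [i, j, k] [a] = 0" "mch [i, j, k] [a, b] = 0"
  "mch [i, j, k] (a # b # c # w) = (if red [a, b, c] = [i, j, k] then 1 else 0) + mch [i, j, k] (b # c # w)"
proof -
  show 0: "mch [i, j, k] [] = 0" by (simp add: mch_def)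
  show "mch [i, j, k] [a] = 0" "mch [i, j, k] [a, b] = 0"
    "mch [i, j, k] (a # b # c # w) = (if red [a, b, c] = [i, j, k] then 1 else 0) + mch [i, j, k] (b # c # w)"
    by (simp_all add: mch_Cons 0)
qed

section \<open>End steps, and the decomposition of 132-avoiding permutations at the maximum\<close>

fun first_desc :: "nat list \<Rightarrow> bool" where
  "first_desc (a # b # w) \<longleftrightarrow> a > b"
| "first_desc _ \<longleftrightarrow> False"

fun last_asc :: "nat list \<Rightarrow> bool" where
  "last_asc (a # b # c # w) \<longleftrightarrow> last_asc (b # c # w)"
| "last_asc [a, b] \<longleftrightarrow> a < b"
| "last_asc _ \<longleftrightarrow> False"

definition glue :: "nat list \<Rightarrow> nat list \<Rightarrow> nat list" where
  "glue l r = map (\<lambda>i. i + length r) l @ Suc (length l + length r) # r"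

text \<open>Inequalities in place of \<open>red\<close> make avoidance easy to carry along a
  strictly monotone relabelling.\<close>

definition avoids_132 :: "nat list \<Rightarrow> bool" where
  "avoids_132 w \<longleftrightarrow> \<not> (\<exists>a b c. subseq [a, b, c] w \<and> a < c \<and> c < b)"

definition Av_132 :: "nat \<Rightarrow> nat list set" where
  "Av_132 n = {w \<in> permutations_of_set {1..n}. avoids_132 w}"

lemma Av_132_length: "w \<in> Av_132 n \<Longrightarrow> length w = n"
  by (auto simp: Av_132_def permutations_of_set_def distinct_card [symmetric])

lemma Av_132_set: "w \<in> Av_132 n \<Longrightarrow> set w = {1..n}"
  by (auto simp: Av_132_def permutations_of_set_def)

lemma Av_132_distinct: "w \<in> Av_132 n \<Longrightarrow> distinct w"
  by (auto simp: Av_132_def permutations_of_set_def)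

lemma finite_Av_132 [simp]: "finite (Av_132 n)"
  by (auto simp: Av_132_def)

lemma avoids_132_iff:
  "avoids w [1, 3, 2] \<longleftrightarrow> avoids_132 w"
proof -
  have "\<exists>a b c. v = [a, b, c]" if "red v = [1, 3, 2]" for v
  proof -
    have "length v = 3" using length_red [of v] that by simp
    then show ?thesis by (auto simp: numeral_3_eq_3 length_Suc_conv)
  qed
  then show ?thesis
    unfolding avoids_def avoids_132_def by (metis red_triple(5))
qed

lemma avoids_132_map_strict_mono:
  fixes f :: "nat \<Rightarrow> nat"
  assumes "strict_mono f"
  shows "avoids_132 (map f w) \<longleftrightarrow> avoids_132 w"
proof
  assume *: "avoids_132 (map f w)"
  show "avoids_132 w"
    unfolding avoids_132_def
  proof clarify
    fix a b c assume "subseq [a, b, c] w" "a < c" "c < b"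
    then have "subseq [f a, f b, f c] (map f w)" "f a < f c" "f c < f b"
      using subseq_map [of "[a, b, c]" w f] assms by (auto simp: strict_mono_less)
    then show False using * unfolding avoids_132_def by blast
  qed
next
  assume *: "avoids_132 w"
  show "avoids_132 (map f w)"
    unfolding avoids_132_def
  proof clarify
    fix a b c assume "subseq [a, b, c] (map f w)" and less: "a < c" "c < b"
    then obtain v where v: "subseq v w" "[a, b, c] = map f v"
      by (metis nths_map subseq_conv_nths)
    then obtain a' b' c' where "v = [a', b', c']" "a = f a'" "b = f b'" "c = f c'"
      by (auto simp: Cons_eq_map_conv)
    moreover from this have "a' < c'" "c' < b'"
      using less assms by (simp_all add: strict_mono_less)
    ultimately show False
      using * v(1) unfolding avoids_132_def by blast
  qed
qed

text \<open>No occurrence meets both sides: if \<open>a\<close> lies in \<open>l\<close> and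
  \<open>c\<close> in \<open>m # r\<close>, then \<open>c\<close> is \<open>m\<close>, which
  \<open>b\<close> cannot exceed, or \<open>c\<close> lies in \<open>r\<close>, below
  \<open>a\<close>. Nor can the maximum \<open>m\<close> play the smallest letter.\<close>

lemma avoids_132_append_Cons:
  assumes "\<And>x. x \<in> set l \<Longrightarrow> x < m" "\<And>y. y \<in> set r \<Longrightarrow> y < m"
    and "\<And>x y. x \<in> set l \<Longrightarrow> y \<in> set r \<Longrightarrow> y < x"
  shows "avoids_132 (l @ m # r) \<longleftrightarrow> avoids_132 l \<and> avoids_132 r"
proof
  assume *: "avoids_132 (l @ m # r)"
  have "subseq l (l @ m # r)" "subseq r (l @ m # r)"
    by (auto intro: subseq_rev_drop_many list_emb_append2)
  then show "avoids_132 l \<and> avoids_132 r"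
    using * unfolding avoids_132_def by (meson subseq_order.order_trans)
next
  assume *: "avoids_132 l \<and> avoids_132 r"
  show "avoids_132 (l @ m # r)"
    unfolding avoids_132_def
  proof clarify
    fix a b c assume "subseq [a, b, c] (l @ m # r)" and less: "a < c" "c < b"
    then obtain u v where uv: "[a, b, c] = u @ v" "subseq u l" "subseq v (m # r)"
      by (metis subseq_append_iff)
    have sets: "set u \<subseteq> set l" "set v \<subseteq> set (m # r)"
      using uv(2,3) by (metis set_nths_subset subseq_conv_nths)+
    \<comment> \<open>Cuts after one and after two letters merge into one case, since it matters
      only that \<open>a\<close> is on the left and \<open>c\<close> on the right.\<close>
    have "u = [] \<and> v = [a, b, c] \<or> u = [a] \<and> v = [b, c] \<or> u = [a, b] \<and> v = [c] \<or> u = [a, b, c]"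
      using uv(1) by (auto simp: Cons_eq_append_conv)
    then consider "v = [a, b, c]" | "a \<in> set u" "b \<in> set u \<union> set v" "c \<in> set v" | "u = [a, b, c]"
      by auto
    then show False
    proof cases
      case 1
      then have "b \<le> m" "c \<le> m" using sets assms(2) by (auto intro: less_imp_le)
      then have "a \<noteq> m" using less by auto
      then have "subseq [a, b, c] r" using uv(3) 1 by (simp add: subseq_Cons2_neq)
      then show False using * less unfolding avoids_132_def by blast
    next
      case 2
      then have "a \<in> set l" "b \<in> set l \<union> set (m # r)" "c \<in> set (m # r)" using sets by auto
      then have "b \<le> m" "c \<noteq> m \<Longrightarrow> c < a" using assms by (auto intro: less_imp_le)
      then show False using less by auto
    next
      case 3
      then show False using uv * less unfolding avoids_132_def by blast
    qed
  qed
qed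

lemma glue_in_Av_132:
  assumes "l \<in> Av_132 k" "r \<in> Av_132 j"
  shows "glue l r \<in> Av_132 (Suc (k + j))"
proof -
  note l = Av_132_length [OF assms(1)] Av_132_set [OF assms(1)] Av_132_distinct [OF assms(1)]
  note r = Av_132_length [OF assms(2)] Av_132_set [OF assms(2)] Av_132_distinct [OF assms(2)]
  have shift: "(\<lambda>i. i + j) ` {1..k} = {Suc j..k + j}"
    by (simp add: image_add_atLeastAtMost')
  have "set (glue l r) = {1..Suc (k + j)}"
    using l r shift by (auto simp: glue_def)
  moreover have "distinct (glue l r)"
    using l r by (auto simp: glue_def distinct_map inj_on_def)
  moreover have "avoids_132 (map (\<lambda>i. i + j) l)" "avoids_132 r"
    using assms by (auto simp: Av_132_def avoids_132_map_strict_mono strict_mono_def)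
  then have "avoids_132 (glue l r)"
    using l r unfolding glue_def by (subst avoids_132_append_Cons) auto
  ultimately show ?thesis
    by (simp add: Av_132_def permutations_of_set_def)
qed

text \<open>Equal total lengths give both words the same maximum; it occurs only once, so it marks
  the same cut, and equal right factors mean equal shifts.\<close>

lemma glue_eq_iff:
  assumes "length l + length r = length l' + length r'"
    and "set l \<subseteq> {1..length l}" "set l' \<subseteq> {1..length l'}"
      "set r \<subseteq> {1..length r}" "set r' \<subseteq> {1..length r'}"
  shows "glue l r = glue l' r' \<longleftrightarrow> l = l' \<and> r = r'"
proof
  assume *: "glue l r = glue l' r'"
  let ?m = "Suc (length l + length r)"
  have "map (\<lambda>i. i + length r) l @ ?m # r = map (\<lambda>i. i + length r') l' @ ?m # r'"
    using * assms(1) by (simp add: glue_def)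
  moreover have "?m \<notin> set (map (\<lambda>i. i + length r) l)" "?m \<notin> set r"
    using assms by auto
  ultimately have "map (\<lambda>i. i + length r) l = map (\<lambda>i. i + length r') l' \<and> r = r'"
    using append_Cons_eq_iff by metis
  then show "l = l' \<and> r = r'"
    by (auto dest: inj_mapD [rotated] simp: inj_on_def)
qed auto

text \<open>Cut at the maximum. A letter \<open>x\<close> on its left below a letter
  \<open>y\<close> on its right would form 132 with it, so the right part holds exactly the smallest
  letters, and lowering the left part standardises it.\<close>

lemma glue_cases:
  assumes w: "w \<in> Av_132 (Suc n)"
  obtains l r where "w = glue l r" "length l \<le> n"
    "l \<in> Av_132 (length l)" "r \<in> Av_132 (n - length l)"
proof -
  note w' = Av_132_length [OF w] Av_132_set [OF w] Av_132_distinct [OF w]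
  have "Suc n \<in> set w" using w' by simp
  then obtain l r where w_eq: "w = l @ Suc n # r"
    by (meson split_list)
  have disj: "distinct l" "distinct r" "set l \<inter> set r = {}" "Suc n \<notin> set l" "Suc n \<notin> set r"
    using w' w_eq by auto
  have "insert (Suc n) (set l \<union> set r) = insert (Suc n) {1..n}"
    using w' w_eq by (simp add: atLeastAtMostSuc_conv)
  then have un: "set l \<union> set r = {1..n}"
    using disj by (subst (asm) insert_ident) auto
  have len: "length l + length r = n" using w' w_eq by simp
  have av: "avoids_132 w" using w by (simp add: Av_132_def)
  have less: "y < x" if "x \<in> set l" "y \<in> set r" for x y
  proof (rule ccontr)
    assume "\<not> y < x"
    then have "x < y" using disj that by (metis disjoint_iff linorder_neqE_nat)
    moreover have "y < Suc n" using that(2) un by (auto simp: set_eq_iff less_Suc_eq_le)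
    moreover have "subseq ([x] @ [Suc n] @ [y]) (l @ [Suc n] @ r)"
      using that by (intro list_emb_append_mono) (auto simp: subseq_singleton_left)
    ultimately show False
      using av w_eq unfolding avoids_132_def by (metis append_Cons append_Nil)
  qed
  define j where "j = length r"
  have card_r: "card (set r) = j" using disj by (simp add: distinct_card j_def)
  have r_le: "y \<le> j" if y: "y \<in> set r" for y
  proof -
    \<comment> \<open>All letters of \<open>l\<close> exceed \<open>y\<close>, so the letters up to
      \<open>y\<close> lie in \<open>r\<close>; counting them bounds \<open>y\<close>.\<close>
    have "{1..y} \<subseteq> set r"
    proof
      fix z assume "z \<in> {1..y}"
      moreover have "y \<le> n" using un y by auto
      ultimately have "z \<in> set l \<union> set r" "\<not> y < z" unfolding un by auto
      then show "z \<in> set r" using less [OF _ y] by blast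
    qed
    then have "card {1..y} \<le> j" unfolding card_r [symmetric] by (intro card_mono) auto
    then show ?thesis by simp
  qed
  have set_r: "set r = {1..j}"
    by (rule card_subset_eq) (use r_le un card_r in auto)
  have "x \<in> set l \<longleftrightarrow> x \<in> {1..n} \<and> x \<notin> {1..j}" for x
    using disj(3) unfolding un [symmetric] set_r [symmetric] by blast
  then have set_l: "set l = {Suc j..n}" by (intro set_eqI) (simp, linarith)
  define l' where "l' = map (\<lambda>i. i - j) l"
  have l_eq: "map (\<lambda>i. i + j) l' = l"
    unfolding l'_def map_map by (rule map_idI) (use set_l in auto)
  have len': "length l' = n - j" using len by (simp add: l'_def j_def)
  have "(\<lambda>i. i - j) ` {Suc j..n} = {1..n - j}"
    by (rule set_eqI) (auto simp: image_iff intro!: bexI [of _ "_ + j"])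
  then have set_l': "set l' = {1..length l'}"
    using set_l len' by (simp add: l'_def)
  have dl': "distinct l'"
    using disj(1) l_eq by (metis distinct_map)
  have "avoids_132 l \<and> avoids_132 r"
    using av less set_l set_r len unfolding w_eq j_def by (subst (asm) avoids_132_append_Cons) auto
  then have "avoids_132 l'" "avoids_132 r"
    using avoids_132_map_strict_mono [of "\<lambda>i. i + j" l'] l_eq by (auto simp: strict_mono_def)
  then have "l' \<in> Av_132 (length l')" "r \<in> Av_132 (n - length l')"
    using dl' set_l' disj(2) set_r len' len by (auto simp: Av_132_def permutations_of_set_def j_def)
  moreover have "w = glue l' r" "length l' \<le> n"
    using w_eq l_eq len' len by (auto simp: glue_def j_def)
  ultimately show ?thesis using that by blast
qed

lemma bij_betw_glue:
  "bij_betw (\<lambda>(k, l, r). glue l r)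
     (SIGMA k:{..n}. Av_132 k \<times> Av_132 (n - k)) (Av_132 (Suc n))"
  unfolding bij_betw_def
proof (intro conjI subset_antisym)
  show "inj_on (\<lambda>(k, l, r). glue l r) (SIGMA k:{..n}. Av_132 k \<times> Av_132 (n - k))"
  proof (rule inj_onI)
    fix p q
    assume pq: "p \<in> (SIGMA k:{..n}. Av_132 k \<times> Av_132 (n - k))"
      "q \<in> (SIGMA k:{..n}. Av_132 k \<times> Av_132 (n - k))"
      "(case p of (k, l, r) \<Rightarrow> glue l r) = (case q of (k, l, r) \<Rightarrow> glue l r)"
    obtain k l r k' l' r' where eq: "p = (k, l, r)" "q = (k', l', r')"
      by (cases p; cases q)
    with pq have A: "l \<in> Av_132 k" "r \<in> Av_132 (n - k)" "l' \<in> Av_132 k'" "r' \<in> Av_132 (n - k')"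
      and "k \<le> n" "k' \<le> n" "glue l r = glue l' r'"
      by auto
    moreover note len = A [THEN Av_132_length]
    moreover note A [THEN Av_132_set]
    ultimately have "l = l' \<and> r = r'"
      by (subst glue_eq_iff [symmetric]) auto
    then show "p = q" using len eq by auto
  qed
  show "(\<lambda>(k, l, r). glue l r) ` (SIGMA k:{..n}. Av_132 k \<times> Av_132 (n - k))
    \<subseteq> Av_132 (Suc n)"
  proof clarsimp
    fix k l r assume "k \<le> n" "l \<in> Av_132 k" "r \<in> Av_132 (n - k)"
    then show "glue l r \<in> Av_132 (Suc n)"
      using glue_in_Av_132 [of l k r "n - k"] by simp
  qed
  show "Av_132 (Suc n)
    \<subseteq> (\<lambda>(k, l, r). glue l r) ` (SIGMA k:{..n}. Av_132 k \<times> Av_132 (n - k))"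
  proof
    fix w assume "w \<in> Av_132 (Suc n)"
    then obtain l r where "w = glue l r" "length l \<le> n"
      "l \<in> Av_132 (length l)" "r \<in> Av_132 (n - length l)"
      by (rule glue_cases)
    then show "w \<in> (\<lambda>(k, l, r). glue l r) ` (SIGMA k:{..n}. Av_132 k \<times> Av_132 (n - k))"
      by (intro image_eqI [of _ _ "(length l, l, r)"]) auto
  qed
qed

lemma Av_132_0: "Av_132 0 = {[]}"
  by (auto simp: Av_132_def permutations_of_set_def avoids_132_def)

section \<open>Generating functions over 132-avoiding permutations\<close>

definition gf :: "(nat list \<Rightarrow> 'a::comm_semiring_1) \<Rightarrow> 'a fps" where
  "gf \<phi> = Abs_fps (\<lambda>n. \<Sum>w\<in>Av_132 n. \<phi> w)"

lemma gf_add: "gf (\<lambda>w. \<phi> w + \<psi> w) = gf \<phi> + gf \<psi>"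
  by (intro fps_ext) (simp add: gf_def sum.distrib)

lemma gf_cmult: "gf (\<lambda>w. c * \<phi> w) = fps_const c * gf \<phi>"
  by (intro fps_ext) (simp add: gf_def sum_distrib_left)

text \<open>With generating function 1, this indicator turns case distinctions on an empty factor
  into summands.\<close>

definition null_ind :: "nat list \<Rightarrow> 'a::comm_semiring_1" where
  "null_ind w = of_bool (w = [])"

lemma gf_null_ind: "gf null_ind = 1"
proof (rule fps_ext)
  fix n
  show "gf null_ind $ n = (1 :: 'a fps) $ n"
  proof (cases n)
    case (Suc m)
    then have "null_ind w = (0 :: 'a)" if "w \<in> Av_132 n" for w
      using Av_132_length [OF that] by (auto simp: null_ind_def)
    then show ?thesis using Suc by (simp add: gf_def)
  qed (use Av_132_0 in \<open>simp add: gf_def null_ind_def\<close>)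
qed

text \<open>Reindexing along \<open>bij_betw_glue\<close> turns a product weight into a Cauchy
  product, and \<open>fps_X\<close> accounts for the maximum. Two products suffice: one for empty
  and one for nonempty left factors.\<close>

lemma gf_glue:
  fixes \<phi> :: "nat list \<Rightarrow> 'a::comm_semiring_1"
  assumes "\<And>j k l r. l \<in> Av_132 j \<Longrightarrow> r \<in> Av_132 k \<Longrightarrow>
      \<phi> (glue l r) = f1 l * g1 r + f2 l * g2 r"
  shows "gf \<phi> = fps_const (\<phi> []) + fps_X * (gf f1 * gf g1 + gf f2 * gf g2)"
proof (rule fps_ext)
  fix n
  let ?A = "\<lambda>n. Av_132 n"
  show "gf \<phi> $ n = (fps_const (\<phi> []) + fps_X * (gf f1 * gf g1 + gf f2 * gf g2)) $ n"
  proof (cases n)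
    case 0
    then show ?thesis using Av_132_0 by (simp add: gf_def)
  next
    case (Suc m)
    have "gf \<phi> $ n = (\<Sum>w\<in>?A (Suc m). \<phi> w)"
      by (simp add: gf_def Suc)
    also have "\<dots> = (\<Sum>(k, l, r)\<in>(SIGMA k:{..m}. ?A k \<times> ?A (m - k)). \<phi> (glue l r))"
      using sum.reindex_bij_betw [OF bij_betw_glue, of \<phi> m]
      by (simp add: case_prod_unfold)
    also have "\<dots> = (\<Sum>k\<le>m. \<Sum>(l, r)\<in>?A k \<times> ?A (m - k). \<phi> (glue l r))"
      by (subst sum.Sigma) auto
    also have "\<dots> = (\<Sum>k\<le>m. \<Sum>l\<in>?A k. \<Sum>r\<in>?A (m - k). \<phi> (glue l r))"
      by (simp add: sum.cartesian_product)
    also have "\<dots> = (\<Sum>k\<le>m. \<Sum>l\<in>?A k. \<Sum>r\<in>?A (m - k). f1 l * g1 r + f2 l * g2 r)"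
      using assms by (intro sum.cong refl) blast
    also have "\<dots> = (gf f1 * gf g1 + gf f2 * gf g2) $ m"
      by (simp add: gf_def fps_mult_nth sum.distrib sum_product atLeast0AtMost)
    finally show ?thesis by (simp add: Suc)
  qed
qed


text \<open>A single letter in \<open>l\<close> is followed by the ascent to \<open>m\<close>, in
  accordance with the value False of \<open>first_desc\<close> on one letter.\<close>

lemma first_desc_append_Cons:
  assumes "\<And>x. x \<in> set l \<Longrightarrow> x < m" "\<And>y. y \<in> set r \<Longrightarrow> y < m"
  shows "first_desc (l @ m # r) \<longleftrightarrow> (if l = [] then r \<noteq> [] else first_desc l)"
proof (cases l rule: first_desc.cases)
  case ("2_2" a)
  then show ?thesis using assms(1) [of a] by auto
qed (use assms(2) in \<open>cases r; auto\<close>)+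

lemma last_asc_append_Cons:
  assumes "\<And>x. x \<in> set l \<Longrightarrow> x < m" "\<And>y. y \<in> set r \<Longrightarrow> y < m"
  shows "last_asc (l @ m # r) \<longleftrightarrow> (if r = [] then l \<noteq> [] else last_asc r)"
  using assms
proof (induction l rule: last_asc.induct)
  case (2 a b)
  then show ?case by (cases r rule: first_desc.cases) (auto dest: less_imp_not_less)
next
  case "3_1"
  then show ?case by (cases r rule: first_desc.cases) (auto dest: less_imp_not_less)
next
  case ("3_2" a)
  then show ?case by (cases r rule: first_desc.cases) (auto dest: less_imp_not_less)
qed auto

lemma first_desc_map_add [simp]: "first_desc (map (\<lambda>i. i + k) w) \<longleftrightarrow> first_desc w"
  by (cases w rule: first_desc.cases) auto

lemma last_asc_map_add [simp]: "last_asc (map (\<lambda>i. i + k) w) \<longleftrightarrow> last_asc w"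
  by (induction w rule: last_asc.induct) auto

section \<open>The functional equations\<close>

locale mch_weights =
  fixes y x1 x2 x3 x4 :: "'a::comm_ring_1"
begin

definition wt :: "nat list \<Rightarrow> 'a" where
  "wt w = y ^ des w * x1 ^ mch [1, 2, 3] w * x2 ^ mch [2, 1, 3] w
     * x3 ^ mch [2, 3, 1] w * x4 ^ mch [3, 2, 1] w"

text \<open>The final 1 covers 312, which carries no variable, as well as 132 and ties, which the
  counted words do not contain.\<close>

definition triple_wt :: "nat \<Rightarrow> nat \<Rightarrow> nat \<Rightarrow> 'a" where
  "triple_wt a b c =
     (if a < b \<and> b < c then x1 else if b < a \<and> a < c then x2
      else if c < a \<and> a < b then x3 else if c < b \<and> b < a then x4 else 1)"

lemma wt_simps [simp]:
  "wt [] = 1" "wt [a] = 1" "wt [a, b] = (if a > b then y else 1)"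
  "wt (a # b # c # w) = (if a > b then y else 1) * triple_wt a b c * wt (b # c # w)"
  unfolding wt_def triple_wt_def des_simps mch_triple_simps red_triple by (auto simp: power_add)

lemma wt_map_add [simp]: "wt (map (\<lambda>i. i + k) w) = wt w"
  by (induction w rule: last_asc.induct) (auto simp: triple_wt_def)

text \<open>\<open>pre_wt\<close> and \<open>post_wt\<close> collect the descents and matches that involve the maximum and lie,
  apart from it, in the word to its left and in the word to its right, respectively.\<close>

definition pre_wt :: "nat list \<Rightarrow> 'a" where
  "pre_wt w = (if length w \<le> 1 then 1 else if last_asc w then x1 else x2)"

definition post_wt :: "nat list \<Rightarrow> 'a" where
  "post_wt w = (if w = [] then 1 else if first_desc w then y * x4 else y)"

text \<open>Putting \<open>m\<close> in front adds a descent and one window, which is 321 if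
  \<open>r\<close> starts with a descent.\<close>

lemma wt_Cons_max:
  assumes "\<And>y. y \<in> set r \<Longrightarrow> y < m"
  shows "wt (m # r) = wt r * post_wt r"
proof (cases r rule: first_desc.cases)
  case (1 a b w)
  then have "a < m" "b < m" using assms by auto
  then show ?thesis using 1 by (simp add: post_wt_def triple_wt_def)
next
  case ("2_2" a)
  then have "a < m" using assms by auto
  then show ?thesis using "2_2" by (simp add: post_wt_def)
qed (simp add: post_wt_def)

lemma wt_Cons_Cons_max:
  assumes "b < m" "\<And>y. y \<in> set r \<Longrightarrow> y < b"
  shows "wt (b # m # r) = wt r * post_wt r * (if r = [] then 1 else x3)"
proof (cases r)
  case Nil
  then show ?thesis using assms by (simp add: post_wt_def)
next
  case (Cons a w)
  have "a < b" using assms Cons by auto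
  then have "wt (b # m # r) = x3 * wt (m # r)"
    using \<open>b < m\<close> Cons by (simp add: triple_wt_def)
  also have "wt (m # r) = wt r * post_wt r"
    using assms by (intro wt_Cons_max) (meson less_trans)
  finally show ?thesis using Cons by simp
qed

text \<open>Letters are peeled off \<open>l\<close> until at most two remain, which does not affect
  \<open>pre_wt\<close>. The last two letters then form 123 or 213 with \<open>m\<close>,
  distinctness excluding a tie, and the window centred at \<open>m\<close> yields
  \<open>x3\<close>.\<close>

lemma wt_append_Cons:
  assumes "\<And>x. x \<in> set l \<Longrightarrow> x < m" "\<And>y. y \<in> set r \<Longrightarrow> y < m"
    and "\<And>x y. x \<in> set l \<Longrightarrow> y \<in> set r \<Longrightarrow> y < x" and "distinct l"
  shows "wt (l @ m # r) =
    wt l * pre_wt l * (wt r * post_wt r) * (if l = [] \<or> r = [] then 1 else x3)"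
  using assms
proof (induction l rule: last_asc.induct)
  case (1 a b c w)
  then have "wt ((b # c # w) @ m # r) =
    wt (b # c # w) * pre_wt (b # c # w) * (wt r * post_wt r) * (if r = [] then 1 else x3)"
    by simp
  then show ?case by (simp add: pre_wt_def algebra_simps)
next
  case (2 a b)
  then have "a < m" "b < m" "a \<noteq> b" by auto
  moreover have "wt (b # m # r) = wt r * post_wt r * (if r = [] then 1 else x3)"
    using 2 by (intro wt_Cons_Cons_max) auto
  ultimately show ?case
    by (simp add: pre_wt_def triple_wt_def)
next
  case "3_1"
  then show ?case using wt_Cons_max [of r m] by (simp add: pre_wt_def)
next
  case ("3_2" a)
  then show ?case using wt_Cons_Cons_max [of a m r] by (simp add: pre_wt_def)
qed

context
  fixes l r j k
  assumes l: "l \<in> Av_132 j" and r: "r \<in> Av_132 k"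
begin

lemma wt_glue:
  "wt (glue l r) = wt l * pre_wt l * (wt r * post_wt r) * (if l = [] \<or> r = [] then 1 else x3)"
  unfolding glue_def
  using Av_132_set [OF l] Av_132_set [OF r] Av_132_distinct [OF l] Av_132_length [OF l] Av_132_length [OF r]
  by (subst wt_append_Cons) (auto simp: distinct_map pre_wt_def)

lemma first_desc_glue: "first_desc (glue l r) \<longleftrightarrow> (if l = [] then r \<noteq> [] else first_desc l)"
  unfolding glue_def
  using Av_132_set [OF l] Av_132_set [OF r] Av_132_length [OF l] Av_132_length [OF r]
  by (subst first_desc_append_Cons) auto

lemma last_asc_glue: "last_asc (glue l r) \<longleftrightarrow> (if r = [] then l \<noteq> [] else last_asc r)"
  unfolding glue_def
  using Av_132_set [OF l] Av_132_set [OF r] Av_132_length [OF l] Av_132_length [OF r]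
  by (subst last_asc_append_Cons) auto

lemma pre_wt_glue:
  "pre_wt (glue l r) = (if r = [] then if l = [] then 1 else x1 else if last_asc r then x1 else x2)"
  using last_asc_glue by (auto simp: pre_wt_def) (auto simp: glue_def)

lemma post_wt_glue:
  "post_wt (glue l r) = (if l = [] then if r = [] then y else y * x4 else if first_desc l then y * x4 else y)"
  using first_desc_glue by (auto simp: post_wt_def) (auto simp: glue_def)

end

lemma glue_neq_Nil [simp]: "glue l r \<noteq> []"
  by (simp add: glue_def)

text \<open>The classes record the first step of a left factor and the last step of a right factor in the
  glued word. A single letter falls under \<open>asc\<close> on the left, where the maximum follows it, and under
  \<open>desc\<close> on the right, where the maximum precedes it.\<close>

definition pre_asc :: "nat list \<Rightarrow> 'a" where
  "pre_asc w = (if w = [] \<or> first_desc w then 0 else wt w * pre_wt w)"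

definition pre_desc :: "nat list \<Rightarrow> 'a" where
  "pre_desc w = (if first_desc w then wt w * pre_wt w else 0)"

definition post_asc :: "nat list \<Rightarrow> 'a" where
  "post_asc w = (if last_asc w then wt w * post_wt w else 0)"

definition post_desc :: "nat list \<Rightarrow> 'a" where
  "post_desc w = (if w = [] \<or> last_asc w then 0 else wt w * post_wt w)"

lemmas class_defs = pre_asc_def pre_desc_def post_asc_def post_desc_def null_ind_def

text \<open>The end steps of the glued word are those of its factors, except where a factor has at
  most one letter. The factor \<open>x3\<close> comes only with two nonempty factors, when the
  maximum has neighbours on both sides.\<close>

lemma class_glue:
  assumes "l \<in> Av_132 j" "r \<in> Av_132 k"
  shows "wt (glue l r) = null_ind l * (null_ind r + (post_asc r + post_desc r))
      + (pre_asc l + pre_desc l) * (null_ind r + x3 * (post_asc r + post_desc r))"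
    and "pre_asc (glue l r) = null_ind l * null_ind r
      + pre_asc l * (x1 * (null_ind r + x3 * post_asc r) + x2 * x3 * post_desc r)"
    and "pre_desc (glue l r) = null_ind l * (x1 * post_asc r + x2 * post_desc r)
      + pre_desc l * (x1 * (null_ind r + x3 * post_asc r) + x2 * x3 * post_desc r)"
    and "post_asc (glue l r) =
      y * (pre_asc l + x4 * pre_desc l) * (null_ind r + x3 * post_asc r)
      + null_ind l * (y * x4 * post_asc r)"
    and "post_desc (glue l r) = null_ind l * (y * (null_ind r + x4 * post_desc r))
      + y * x3 * (pre_asc l + x4 * pre_desc l) * post_desc r"
  using wt_glue [OF assms] first_desc_glue [OF assms] last_asc_glue [OF assms]
    pre_wt_glue [OF assms] post_wt_glue [OF assms]
  by (auto simp: class_defs pre_wt_def post_wt_def algebra_simps)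

text \<open>Each equation is \<open>gf_glue\<close> applied to one identity of
  \<open>class_glue\<close>; the constant term is the value at the empty word.\<close>

lemma functional_equations:
  defines "T \<equiv> fps_X" and "W \<equiv> fps_const y" and "Z1 \<equiv> fps_const x1" and "Z2 \<equiv> fps_const x2"
    and "Z3 \<equiv> fps_const x3" and "Z4 \<equiv> fps_const x4"
  defines "a \<equiv> gf pre_asc" and "d \<equiv> gf pre_desc" and "q \<equiv> gf post_asc" and "b \<equiv> gf post_desc"
  shows "gf wt = 1 + T * (1 + (q + b) + (a + d) * (1 + Z3 * (q + b)))"
    and "a = T * (1 + a * (Z1 * (1 + Z3 * q) + Z2 * Z3 * b))"
    and "d = T * (Z1 * q + Z2 * b + d * (Z1 * (1 + Z3 * q) + Z2 * Z3 * b))"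
    and "q = T * (W * (a + Z4 * d) * (1 + Z3 * q) + W * Z4 * q)"
    and "b = T * (W * (1 + Z4 * b) + W * Z3 * (a + Z4 * d) * b)"
proof -
  have Nil: "wt [] = 1" "pre_asc [] = 0" "pre_desc [] = 0" "post_asc [] = 0" "post_desc [] = 0"
    by (simp_all add: class_defs)
  note simps = gf_add gf_cmult gf_null_ind Nil fps_const_mult [symmetric] fps_const_0_eq_0
    fps_const_1_eq_1 add_0 mult_1 mult_1_right
  note gfs = gf_glue [of wt, OF class_glue(1)] gf_glue [of pre_asc, OF class_glue(2)]
    gf_glue [of pre_desc, OF class_glue(3)] gf_glue [of post_asc, OF class_glue(4)]
    gf_glue [of post_desc, OF class_glue(5)]
  note gfs = gfs [unfolded simps]
  show "gf wt = 1 + T * (1 + (q + b) + (a + d) * (1 + Z3 * (q + b)))"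
    using gfs(1) unfolding assms .
  show "a = T * (1 + a * (Z1 * (1 + Z3 * q) + Z2 * Z3 * b))"
    using gfs(2) unfolding assms .
  show "d = T * (Z1 * q + Z2 * b + d * (Z1 * (1 + Z3 * q) + Z2 * Z3 * b))"
    using gfs(3) unfolding assms .
  show "q = T * (W * (a + Z4 * d) * (1 + Z3 * q) + W * Z4 * q)"
    using gfs(4) unfolding assms by (simp only: mult.assoc)
  show "b = T * (W * (1 + Z4 * b) + W * Z3 * (a + Z4 * d) * b)"
    using gfs(5) unfolding assms by (simp only: mult.assoc)
qed

end


section \<open>Elimination\<close>

lemma elimination:
  fixes t y x1 x2 x3 x4 a d q b A :: "'a::idom"
  defines "c \<equiv> - x1 * x4 * t * y + x1 + x2 * x3 * t * y"
    and "e \<equiv> - x1 * x4 * t + x3 * t + x4"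
    and "G \<equiv> x1 * (1 + x3 * q) + x2 * x3 * b"
    and "H \<equiv> x4 + x3 * (a + x4 * d)"
  defines "g \<equiv> 1 - t * G" and "h \<equiv> 1 - t * y * H"
  defines "r \<equiv> 2 * h - (1 + t * c - t * y * e)"
  assumes a: "a = t * (1 + a * G)"
    and d: "d = t * (x1 * q + x2 * b + d * G)"
    and q: "q = t * (y * (a + x4 * d) * (1 + x3 * q) + y * x4 * q)"
    and b: "b = t * (y * (1 + x4 * b) + y * x3 * (a + x4 * d) * b)"
    and A: "A = 1 + t * (1 + (q + b) + (a + d) * (1 + x3 * (q + b)))"
    and nz: "g \<noteq> 0" "h \<noteq> 0"
  shows "r\<^sup>2 = radicand t y x1 x2 x3 x4"
    and "denom t y x1 x2 x3 x4 * A = numer r t y x1 x2 x3 x4"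
proof -
  \<comment> \<open>The two factors are the values of \<open>(1 + x3 * (a + d)) * g\<close> and
    \<open>(1 + x3 * (q + b)) * h\<close>.\<close>
  define K where "K = (1 + x3 * t - x1 * t) * (1 + t * y * (x3 - x4))"
  \<comment> \<open>For given \<open>G\<close> and \<open>H\<close> the system is linear in the four
    series; cleared of denominators, it needs no division.\<close>
  have ag: "a * g = t" using a unfolding g_def by algebra
  have dg: "d * g = t * (x1 * q + x2 * b)" using d unfolding g_def by algebra
  have bh: "b * h = t * y" using b unfolding h_def H_def by algebra
  have qh: "q * h = t * y * (a + x4 * d)" using q unfolding h_def H_def by algebra
  \<comment> \<open>Multiplication by \<open>h\<close> eliminates \<open>q\<close> and
    \<open>b\<close>, and the remaining terms in \<open>a + x4 * d\<close> cancel.\<close>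
  have Gh: "G * h = c"
  proof -
    have "G * h = x1 * h + x1 * x3 * (q * h) + x2 * x3 * (b * h)"
      by (simp add: G_def algebra_simps)
    also have "\<dots> = c"
      unfolding qh bh unfolding h_def H_def c_def by (simp add: algebra_simps)
    finally show ?thesis .
  qed
  have Hg: "H * g = e"
  proof -
    have "H * g = x4 * g + x3 * (a * g) + x3 * x4 * (d * g)"
      by (simp add: H_def algebra_simps)
    also have "\<dots> = e"
      unfolding ag dg unfolding g_def G_def e_def by (simp add: algebra_simps)
    finally show ?thesis .
  qed
  have gh1: "h - g * h = t * c" unfolding g_def Gh [symmetric] by (simp add: algebra_simps)
  have gh2: "g - g * h = t * y * e" unfolding h_def Hg [symmetric] by (simp add: algebra_simps)
  have gh: "g * h = h - t * c"
    using gh1 by (simp add: algebra_simps)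
  have g_eq: "g = h - t * c + t * y * e"
    using gh2 unfolding gh by (simp add: diff_eq_eq add.commute)
  have quad: "h * h = (1 + t * c - t * y * e) * h - t * c"
    using gh unfolding g_eq by (simp add: algebra_simps)
  have "r\<^sup>2 = 4 * (h * h) - 4 * (1 + t * c - t * y * e) * h + (1 + t * c - t * y * e)\<^sup>2"
    unfolding r_def by (simp add: power2_eq_square algebra_simps)
  also have "\<dots> = (1 + t * c - t * y * e)\<^sup>2 - 4 * t * c"
    unfolding quad by (simp add: algebra_simps)
  also have "\<dots> = radicand t y x1 x2 x3 x4"
    unfolding radicand_def c_def e_def by algebra
  finally show "r\<^sup>2 = radicand t y x1 x2 x3 x4" .
  have "(1 + x3 * (a + d)) * g = 1 + x3 * t - x1 * t"
  proof -
    have "(1 + x3 * (a + d)) * g = g + x3 * (a * g) + x3 * (d * g)"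
      by (simp add: algebra_simps)
    also have "\<dots> = 1 + x3 * t - x1 * t"
      unfolding ag dg unfolding g_def G_def by (simp add: algebra_simps)
    finally show ?thesis .
  qed
  moreover have "(1 + x3 * (q + b)) * h = 1 + t * y * (x3 - x4)"
  proof -
    have "(1 + x3 * (q + b)) * h = h + x3 * (q * h) + x3 * (b * h)"
      by (simp add: algebra_simps)
    also have "\<dots> = 1 + t * y * (x3 - x4)"
      unfolding qh bh unfolding h_def H_def by (simp add: algebra_simps)
    finally show ?thesis .
  qed
  ultimately have UV: "(1 + x3 * (a + d)) * (1 + x3 * (q + b)) * (g * h) = K"
    unfolding K_def by algebra
  have "x3 * A = x3 + t * (x3 - 1 + (1 + x3 * (a + d)) * (1 + x3 * (q + b)))"
    unfolding A by algebra
  then have "x3 * A * (g * h) = (x3 + t * (x3 - 1)) * (g * h)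
      + t * ((1 + x3 * (a + d)) * (1 + x3 * (q + b)) * (g * h))"
    by algebra
  then have x3A: "x3 * A * (g * h) = (x3 + t * (x3 - 1)) * (g * h) + t * K"
    unfolding UV .
  \<comment> \<open>The left side is \<open>g * h * (1 - g) * (1 - h)\<close>; thus
    \<open>c * e\<close> in the denominator supplies the factor \<open>g * h\<close> to be
    cancelled.\<close>
  have e_c: "t * c * (t * y * e) = g * h * (1 - t * y * e - h)"
    unfolding gh using quad by (simp add: algebra_simps)
  have "denom t y x1 x2 x3 x4 * A = 2 * t * y * e * c * (x3 * A)"
    unfolding denom_def c_def e_def by (simp add: ac_simps)
  then have "g * h * (denom t y x1 x2 x3 x4 * A) = 2 * t * y * e * c * (x3 * A * (g * h))"
    by (simp only: ac_simps)
  also have "\<dots> = g * h * (2 * t * y * e * c * (x3 + t * (x3 - 1))) + 2 * K * (t * c * (t * y * e))"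
    unfolding x3A by algebra
  also have "\<dots> = g * h * (2 * t * y * e * c * (x3 + t * (x3 - 1)) + 2 * K * (1 - t * y * e - h))"
    unfolding e_c by algebra
  finally have "denom t y x1 x2 x3 x4 * A =
      2 * t * y * e * c * (x3 + t * (x3 - 1)) + 2 * K * (1 - t * y * e - h)"
    using nz by (simp only: mult_cancel_left) simp
  \<comment> \<open>Expressing \<open>2 * h\<close> through \<open>r\<close> leaves the root only in
    \<open>- K * r\<close>, the square-root term of \<open>numer\<close>.\<close>
  also have "\<dots> = 2 * t * y * e * c * (x3 + t * (x3 - 1)) + K * (1 - t * y * e - t * c) - K * r"
    unfolding r_def by algebra
  also have "\<dots> = numer r t y x1 x2 x3 x4"
    unfolding numer_def K_def c_def e_def by algebra
  finally show "denom t y x1 x2 x3 x4 * A = numer r t y x1 x2 x3 x4" .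
qed


section \<open>The closed form over the polynomial ring\<close>

lemma (in mch_weights) gf_des_mch_eq: "gf_des_mch y x1 x2 x3 x4 = gf wt"
proof -
  have "Av n [1, 3, 2] = Av_132 n" for n
    by (auto simp only: Av_def Av_132_def avoids_132_iff)
  then show ?thesis
    by (simp only: gf_des_mch_def gf_def wt_def)
qed

theorem theorem8:
  fixes A N D t y x1 x2 x3 x4 :: "qpoly fps"
  defines "A \<equiv> gf_des_mch Y X1 X2 X3 X4"
    and "t \<equiv> fps_X"
    and "y \<equiv> fps_const Y"
    and "x1 \<equiv> fps_const X1" and "x2 \<equiv> fps_const X2"
    and "x3 \<equiv> fps_const X3" and "x4 \<equiv> fps_const X4"
    and "N \<equiv> numer (fps_sqrt1 (radicand t y x1 x2 x3 x4)) t y x1 x2 x3 x4"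
    and "D \<equiv> denom t y x1 x2 x3 x4"
  shows "D \<noteq> 0 \<and> Fraction_Field.Fract A 1 = Fraction_Field.Fract N D"
proof -
  interpret mch_weights Y X1 X2 X3 X4 .
  define a d q b where "a = gf pre_asc" and "d = gf pre_desc" and "q = gf post_asc" and "b = gf post_desc"
  note eqs = functional_equations [folded a_def d_def q_def b_def t_def y_def x1_def x2_def x3_def x4_def,
      folded gf_des_mch_eq A_def]
  define h where "h = 1 - t * y * (x4 + x3 * (a + x4 * d))"
  define r where "r = 2 * h - (1 + t * (- x1 * x4 * t * y + x1 + x2 * x3 * t * y)
    - t * y * (- x1 * x4 * t + x3 * t + x4))"
  have nth_0: "fps_nth (1 - t * s) 0 = 1" "fps_nth (1 - t * y * s) 0 = 1" for s
    by (simp_all add: t_def)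
  then have nz: "1 - t * (x1 * (1 + x3 * q) + x2 * x3 * b) \<noteq> 0" "h \<noteq> 0"
    unfolding h_def by (metis fps_zero_nth zero_neq_one)+
  note id = elimination [OF eqs(2,3,4,5,1) nz(1) nz(2) [unfolded h_def], folded h_def, folded r_def]
  \<comment> \<open>As \<open>h\<close> has constant term 1, this selects \<open>r\<close> rather
    than \<open>- r\<close> as the square root.\<close>
  have "fps_nth r 0 = 1"
    by (simp add: r_def h_def t_def)
  with id(1) have "fps_sqrt1 (radicand t y x1 x2 x3 x4) = r"
    unfolding fps_sqrt1_def by (intro the_equality) (auto intro: fps_sqrt1_unique)
  with id(2) have "D * A = N"
    by (simp add: D_def N_def)
  moreover have "D \<noteq> 0"
  proof -
    \<comment> \<open>The two nontrivial factors of \<open>D\<close> have constant terms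
      \<open>X4\<close> and \<open>X1\<close>.\<close>
    have "fps_nth (- x1 * x4 * t + x3 * t + x4) 0 \<noteq> 0"
      by (simp add: t_def x4_def X4_def)
    then have 1: "- x1 * x4 * t + x3 * t + x4 \<noteq> 0" by (metis fps_zero_nth)
    have "fps_nth (- x1 * x4 * t * y + x1 + x2 * x3 * t * y) 0 \<noteq> 0"
      by (simp add: t_def x1_def X1_def)
    then have 2: "- x1 * x4 * t * y + x1 + x2 * x3 * t * y \<noteq> 0" by (metis fps_zero_nth)
    have "x3 \<noteq> 0" "y \<noteq> 0" "t \<noteq> 0"
      by (simp_all add: x3_def y_def t_def X3_def Y_def)
    with 1 2 show ?thesis by (simp add: D_def denom_def)
  qed
  ultimately show ?thesis
    by (simp add: eq_fract mult.commute)
qed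

end
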